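(* Let $D=(d_i)_{i=1}^d$ be a dictionary of $d$ vectors in $\mathbb{C}^N$, let $k$ be a positive integer (the sparsity level), let $(f_i)_{i=1}^m$ be vectors in $\mathbb{C}^N$, and let $\mathcal{A}:\mathbb{C}^{N\times N}\to\mathbb{C}^m$, $\mathcal{A}(H)=(\langle H,f_if_i^*\rangle_{HS})_{i=1}^m$, be the associated PhaseLift operator. Then the following two statements hold. (1) If for every $\mathcal{K}\subseteq\{1,\dots,d\}$ with $|\mathcal{K}|=2k$ the kernel of $\mathcal{A}$ does not contain Hermitian matrices of rank $1$ or $2$ whose range is in $W_{\mathcal{K}}$, then the vectors $(f_i)_{i=1}^m$ allow $kD$-phase retrieval. (2) If $(f_i)_{i=1}^m$ allows $kD$-phase retrieval, then for every $\mathcal{K}\subseteq\{1,\dots,d\}$ with $|\mathcal{K}|=k$ the kernel of $\mathcal{A}$ does not contain Hermitian matrices of rank $1$ or $2$ with range in $W_{\mathcal{K}}$.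
   Context: The scalar product on $\mathbb{C}^N$ is $\langle x,y\rangle=\sum_j\overline{x(j)}\,y(j)$, and $\langle A,B\rangle_{HS}=\mathrm{tr}(A^*B)$. A dictionary $D$ is a set of $d$ vectors $d_1,\dots,d_d$ in $\mathbb{C}^N$, identified with the $N\times d$ matrix having these vectors as columns. For $\mathcal{K}\subseteq\{1,\dots,d\}$, $W_{\mathcal{K}}=\mathrm{span}\{d_i\}_{i\in\mathcal{K}}$. $\|z\|_0$ is the number of non-zero entries of $z$. The class of $kD$-sparse signals is $\mathcal{C}_{k,D}=\{x\in\mathbb{C}^N:\exists z\in\mathbb{C}^d,\ \|z\|_0\le k,\ x=Dz\}$. Let $\mathbb{T}=\{c\in\mathbb{C}:|c|=1\}$. The vectors $(f_i)_{i=1}^m$ allow $kD$-phase retrieval if the map $x\mapsto(|\langle x,f_i\rangle|^2)_{i=1}^m$ is injective on $\mathcal{C}_{k,D}/\mathbb{T}$; i.e. whenever $x,y\in\mathcal{C}_{k,D}$ satisfy $|\langle x,f_i\rangle|=|\langle y,f_i\rangle|$ for all $i$, there is $c\in\mathbb{T}$ with $x=cy$.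
   Formalization: Statement (1) is given under the added assumption 2k ≤ d; otherwise no K with |K| = 2k exists and the claim fails, e.g. N = d = m = k = 1, D = (1), f_1 = 0 with the signals 1 and 2. *)

theory Defs
  imports "HOL-Analysis.Analysis"
begin

text \<open>
  The spaces \<open>\<complex>\<^sup>N\<close>, \<open>\<complex>\<^sup>d\<close>, \<open>\<complex>\<^sup>m\<close> are indexed by finite types \<open>'n\<close>, \<open>'d\<close>, \<open>'m\<close>.
  A dictionary is the \<open>N \<times> d\<close> matrix \<open>D :: complex^'d^'n\<close>; its vectors are the columns
  \<open>column i D\<close>. All spans and ranks are over the complex field.
\<close>

text \<open>Conjugate-linear in the first argument, unlike many library conventions.\<close>

definition cscalar :: "complex^'n \<Rightarrow> complex^'n \<Rightarrow> complex" where
  "cscalar x y = (\<Sum>j\<in>UNIV. cnj (x $ j) * y $ j)"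

definition conj_transpose :: "complex^'n^'m \<Rightarrow> complex^'m^'n" where
  "conj_transpose A = (\<chi> i j. cnj (A $ j $ i))"

definition hermitian :: "complex^'n^'n \<Rightarrow> bool" where
  "hermitian A \<longleftrightarrow> conj_transpose A = A"

definition hs_scalar :: "complex^'n^'n \<Rightarrow> complex^'n^'n \<Rightarrow> complex" where
  "hs_scalar A B = trace (conj_transpose A ** B)"

text \<open>The rank-one matrix \<open>v v\<^sup>*\<close>.\<close>

definition self_outer :: "complex^'n \<Rightarrow> complex^'n^'n" where
  "self_outer v = (\<chi> i j. v $ i * cnj (v $ j))"

definition mat_range :: "complex^'n^'m \<Rightarrow> (complex^'m) set" where
  "mat_range A = range (\<lambda>v. A *v v)"

definition dict_span :: "complex^'d^'n \<Rightarrow> 'd set \<Rightarrow> (complex^'n) set" where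
  "dict_span D K = vec.span ((\<lambda>i. column i D) ` K)"

definition l0_norm :: "complex^'d \<Rightarrow> nat" where
  "l0_norm z = card {j. z $ j \<noteq> 0}"

definition sparse_signals :: "nat \<Rightarrow> complex^'d^'n \<Rightarrow> (complex^'n) set" where
  "sparse_signals k D = {x. \<exists>z. l0_norm z \<le> k \<and> x = D *v z}"

text \<open>
  Injectivity of \<open>x \<mapsto> (\<bar>\<langle>x, f\<^sub>i\<rangle>\<bar>\<^sup>2)\<^sub>i\<close> on the sparse signals
  modulo unimodular scalars.
\<close>

definition allows_phase_retrieval ::
  "nat \<Rightarrow> complex^'d^'n \<Rightarrow> ('m \<Rightarrow> complex^'n) \<Rightarrow> bool" where
  "allows_phase_retrieval k D f \<longleftrightarrow>
     (\<forall>x\<in>sparse_signals k D. \<forall>y\<in>sparse_signals k D.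
        (\<forall>i. (cmod (cscalar x (f i)))\<^sup>2 = (cmod (cscalar y (f i)))\<^sup>2) \<longrightarrow>
        (\<exists>c. cmod c = 1 \<and> x = c *s y))"

definition phaselift :: "('m::finite \<Rightarrow> complex^'n) \<Rightarrow> complex^'n^'n \<Rightarrow> complex^'m" where
  "phaselift f H = (\<chi> i. hs_scalar H (self_outer (f i)))"

definition phaselift_kernel :: "('m::finite \<Rightarrow> complex^'n) \<Rightarrow> (complex^'n^'n) set" where
  "phaselift_kernel f = {H. phaselift f H = 0}"

end

theory Submission imports Defs begin

text \<open>
  Lifting makes phase retrieval linear: for a Hermitian matrix \<open>H\<close>, the \<open>i\<close>-th lifted measurement
  is \<open>\<langle>H f\<^sub>i, f\<^sub>i\<rangle>\<close>, which is the phaseless measurement \<open>\<bar>\<langle>x, f\<^sub>i\<rangle>\<bar>\<^sup>2\<close> when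
  \<open>H = x x\<^sup>*\<close>. Two signals with equal measurements therefore differ, after lifting, by the
  kernel element \<open>x x\<^sup>* - y y\<^sup>*\<close> of rank at most two; it vanishes exactly if the signals agree up
  to phase (\<open>self_outer_eq_imp_phase\<close>). Its range lies in a span of \<open>2 k\<close> dictionary vectors,
  since the supports of the two signals have to be united. This is
  \<open>phase_retrieval_if_kernel_avoids\<close>.

  Conversely, a nonzero Hermitian matrix of rank at most two is a real combination
  \<open>a u u\<^sup>* + b w w\<^sup>*\<close> of outer products of vectors from its range
  (\<open>hermitian_rank_le_2_decomposition\<close>), so a kernel element yields two sparse signals that the
  measurements confuse: multiples of \<open>u\<close> and \<open>w\<close> when the form is indefinite, \<open>u\<close> and \<open>0\<close>
  when it is semidefinite. Both come from the one range, so no doubling occurs. This is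
  \<open>kernel_avoids_if_phase_retrieval\<close>. The decomposition is obtained by completing the square twice
  (\<open>hermitian_deflation\<close>) in place of the spectral theorem.
\<close>

section \<open>The scalar product\<close>

lemma cscalar_add_left: "cscalar (x + y) z = cscalar x z + cscalar y z"
  by (simp add: cscalar_def distrib_right sum.distrib)

lemma cscalar_add_right: "cscalar x (y + z) = cscalar x y + cscalar x z"
  by (simp add: cscalar_def distrib_left sum.distrib)

lemma cscalar_scale_left: "cscalar (c *s x) y = cnj c * cscalar x y"
  by (simp add: cscalar_def sum_distrib_left mult.assoc)

lemma cscalar_scale_right: "cscalar x (c *s y) = c * cscalar x y"
  by (simp add: cscalar_def sum_distrib_left mult.left_commute)

lemma cscalar_scaleR_left: "cscalar (a *\<^sub>R x) y = complex_of_real a * cscalar x y"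
  by (simp add: cscalar_def scaleR_conv_of_real[where 'a = complex] sum_distrib_left mult.assoc)

lemma cscalar_zero_left [simp]: "cscalar 0 x = 0"
  and cscalar_zero_right [simp]: "cscalar x 0 = 0"
  by (simp_all add: cscalar_def)

lemma cnj_cscalar: "cnj (cscalar x y) = cscalar y x"
  by (simp add: cscalar_def mult.commute)

lemma cscalar_self_eq_0_iff: "cscalar x x = 0 \<longleftrightarrow> x = 0"
proof
  assume "cscalar x x = 0"
  moreover have "cscalar x x = complex_of_real (\<Sum>j\<in>UNIV. (cmod (x $ j))\<^sup>2)"
    unfolding cscalar_def of_real_sum
    by (intro sum.cong refl) (metis complex_norm_square mult.commute)
  ultimately have "(\<Sum>j\<in>UNIV. (cmod (x $ j))\<^sup>2) = 0"
    using of_real_eq_0_iff by metis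
  then show "x = 0"
    by (subst (asm) sum_nonneg_eq_0_iff) (auto simp: vec_eq_iff)
qed simp

lemma self_outer_mult_vec: "self_outer u *v z = cscalar u z *s u"
  by (simp add: vec_eq_iff matrix_vector_mult_def self_outer_def cscalar_def sum_distrib_left
      sum_distrib_right mult_ac)

lemma scaleR_matrix_mult_vec: "(a *\<^sub>R A) *v z = a *\<^sub>R (A *v z)" for A :: "complex^'n^'m"
  by (simp add: vec_eq_iff matrix_vector_mult_def scaleR_sum_right)

section \<open>Hermitian matrices and deflation\<close>

lemma hermitian_iff_entries: "hermitian H \<longleftrightarrow> (\<forall>i j. cnj (H $ j $ i) = H $ i $ j)"
  by (simp add: hermitian_def conj_transpose_def vec_eq_iff)

lemma hermitian_diff: "hermitian A \<Longrightarrow> hermitian B \<Longrightarrow> hermitian (A - B)"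
  by (simp add: hermitian_iff_entries)

lemma hermitian_scaleR_self_outer: "hermitian (a *\<^sub>R self_outer u)"
  by (simp add: hermitian_iff_entries self_outer_def mult.commute)

lemma hermitian_cscalar_swap:
  assumes "hermitian H"
  shows "cscalar x (H *v y) = cscalar (H *v x) y"
proof -
  have "cscalar x (H *v y) = (\<Sum>i\<in>UNIV. \<Sum>j\<in>UNIV. cnj (x $ i) * (H $ i $ j * y $ j))"
    by (simp add: cscalar_def matrix_vector_mult_def sum_distrib_left)
  also have "\<dots> = (\<Sum>j\<in>UNIV. \<Sum>i\<in>UNIV. cnj (x $ i) * (H $ i $ j * y $ j))"
    by (rule sum.swap)
  also have "\<dots> = cscalar (H *v x) y"
    using assms[unfolded hermitian_iff_entries]
    by (simp add: cscalar_def matrix_vector_mult_def sum_distrib_left sum_distrib_right mult_ac)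
  finally show ?thesis .
qed

text \<open>
  The quadratic form determines the sesquilinear form by polarization; hence it cannot vanish
  identically unless the matrix is zero.
\<close>

lemma hermitian_nonzero_quadratic_form:
  assumes "hermitian H" "H \<noteq> 0"
  obtains v where "cscalar v (H *v v) \<noteq> 0"
proof -
  have "H = 0" if q: "\<And>v. cscalar v (H *v v) = 0"
  proof -
    have "cscalar x (H *v y) = 0" for x y
    proof -
      have "cscalar x (H *v y) + cscalar y (H *v x) = 0"
        using q[of "x + y"] q[of x] q[of y]
        by (simp add: matrix_vector_right_distrib cscalar_add_left cscalar_add_right
            add.commute)
      moreover have "\<i> * cscalar x (H *v y) - \<i> * cscalar y (H *v x) = 0"
        using q[of "x + \<i> *s y"] q[of x] q[of y]
        by (simp add: matrix_vector_right_distrib vector_scalar_commute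
            cscalar_add_left cscalar_add_right cscalar_scale_left cscalar_scale_right)
      then have "cscalar x (H *v y) = cscalar y (H *v x)"
        by simp
      ultimately show ?thesis
        by (simp flip: mult_2)
    qed
    then have "H *v y = 0" for y
      using cscalar_self_eq_0_iff by blast
    then show "H = 0"
      by (simp add: matrix_eq)
  qed
  with assms(2) that show ?thesis
    by blast
qed

lemma rank_eq_0_iff_field: "rank A = 0 \<longleftrightarrow> A = 0" for A :: "'a::field^'n^'m"
proof
  assume "rank A = 0"
  then have "row i A = 0" for i
    by (auto simp: row_rank_def_gen rows_def)
  then show "A = 0"
    by (simp add: row_def vec_eq_iff)
qed (auto simp: row_rank_def_gen rows_def row_def vec_eq_iff)

text \<open>
  Since \<^const>\<open>rank\<close> is the dimension of the row space, the kernel can be used to show that an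
  inclusion of row spaces is proper: \<open>v\<close> annihilates every row of \<open>B\<close> but not every row of \<open>A\<close>.
\<close>

lemma rank_less_if_kernel_grows:
  fixes A B :: "'a::field^'n^'m"
  assumes rows: "rows B \<subseteq> vec.span (rows A)"
    and Bv: "B *v v = 0" and Av: "A *v v \<noteq> 0"
  shows "rank B < rank A"
proof -
  let ?Z = "{r :: 'a^'n. (\<Sum>j\<in>UNIV. r $ j * v $ j) = 0}"
  have "vec.subspace ?Z"
    by (auto simp: vec.subspace_def distrib_right sum.distrib mult.assoc
        simp flip: sum_distrib_left)
  moreover have "rows B \<subseteq> ?Z"
    using Bv by (auto simp: rows_def row_def matrix_vector_mult_def vec_eq_iff)
  ultimately have B: "vec.span (rows B) \<subseteq> ?Z"
    by (rule vec.span_minimal[rotated])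
  obtain i where "row i A \<notin> ?Z"
    using Av by (auto simp: row_def matrix_vector_mult_def vec_eq_iff)
  moreover have "row i A \<in> vec.span (rows A)"
    by (rule vec.span_base) (auto simp: rows_def)
  ultimately have "vec.span (rows B) \<noteq> vec.span (rows A)"
    using B by blast
  moreover have "vec.span (rows B) \<subseteq> vec.span (rows A)"
    using rows by (simp add: vec.span_minimal)
  ultimately show ?thesis
    unfolding row_rank_def_gen by (intro vec.dim_psubset) blast
qed

text \<open>
  Completing the square in the Hermitian form: subtracting the rank-one matrix built from
  \<open>u = H v\<close>, scaled so that \<open>v\<close> enters the kernel, lowers the rank. The vector \<open>v\<close> is kept as
  a witness: it is orthogonal to the range of the remainder but not to \<open>u\<close>, so \<open>u\<close> is not in
  that range.
\<close>

lemma hermitian_deflation: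
  assumes H: "hermitian H" "H \<noteq> 0"
  obtains a u v where "a \<noteq> 0" "u \<in> mat_range H" "hermitian (H - a *\<^sub>R self_outer u)"
    "rank (H - a *\<^sub>R self_outer u) < rank H"
    "(H - a *\<^sub>R self_outer u) *v v = 0" "cscalar v u \<noteq> 0"
proof -
  obtain v where v: "cscalar v (H *v v) \<noteq> 0"
    using hermitian_nonzero_quadratic_form[OF H] .
  define u where "u = H *v v"
  have "cnj (cscalar v u) = cscalar v u"
    using hermitian_cscalar_swap[OF H(1), of v v] by (simp add: cnj_cscalar u_def)
  then obtain q where q: "cscalar v u = complex_of_real q"
    by (metis Reals_cnj_iff Reals_cases)
  have quv: "cscalar u v = complex_of_real q"
    using q cnj_cscalar[of v u] by simp
  have q0: "q \<noteq> 0"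
    using v q by (auto simp: u_def)
  let ?R = "H - (1 / q) *\<^sub>R self_outer u"
  have herm: "hermitian ?R"
    by (intro hermitian_diff H hermitian_scaleR_self_outer)
  have Rv: "?R *v v = 0"
    using q0 quv
    by (simp add: matrix_vector_mult_diff_rdistrib scaleR_matrix_mult_vec self_outer_mult_vec
        vec_eq_iff scaleR_conv_of_real[where 'a = complex] flip: u_def)
  have "rows ?R \<subseteq> vec.span (rows H)"
  proof
    fix r assume "r \<in> rows ?R"
    then obtain i where "r = row i ?R"
      by (auto simp: rows_def)
    \<comment> \<open>The rows of the rank-one matrix are multiples of \<open>u\<^sup>* = v\<^sup>* H\<close>, a combination
      of the rows of \<open>H\<close>.\<close>
    then have "r = row i H - (complex_of_real (1 / q) * u $ i) *s
        (\<Sum>l\<in>UNIV. cnj (v $ l) *s row l H)"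
      using H(1)
      by (simp add: vec_eq_iff row_def self_outer_def u_def matrix_vector_mult_def
          scaleR_conv_of_real[where 'a = complex] hermitian_iff_entries mult_ac)
    then show "r \<in> vec.span (rows H)"
      by (auto intro!: vec.span_diff vec.span_scale vec.span_sum intro: vec.span_base
          simp: rows_def)
  qed
  then have "rank ?R < rank H"
    using Rv v by (intro rank_less_if_kernel_grows[where v = v]) auto
  with herm Rv q0 q show ?thesis
    by (intro that[of "1 / q" u v]) (auto simp: mat_range_def u_def)
qed

lemma mat_range_cmul: "x \<in> mat_range A \<Longrightarrow> c *s x \<in> mat_range A"
  by (force simp: mat_range_def simp flip: vector_scalar_commute)

lemma mat_range_add: "x \<in> mat_range A \<Longrightarrow> y \<in> mat_range A \<Longrightarrow> x + y \<in> mat_range A"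
  by (force simp: mat_range_def simp flip: matrix_vector_right_distrib)

text \<open>
  Deflating twice exhausts a matrix of rank at most two. The second vector lies in the range of the
  first remainder, to which the witness of the first step is orthogonal, so the first vector is not
  a multiple of it. For rank one the second vector is zero.
\<close>

lemma hermitian_rank_le_2_decomposition:
  assumes H: "hermitian H" "H \<noteq> 0" "rank H \<le> 2"
  obtains a b u w where "a \<noteq> 0" "u \<in> mat_range H" "w \<in> mat_range H"
    "H = a *\<^sub>R self_outer u + b *\<^sub>R self_outer w" "\<And>c. u \<noteq> c *s w"
proof -
  obtain a u v where u: "a \<noteq> 0" "u \<in> mat_range H" "hermitian (H - a *\<^sub>R self_outer u)"
    "rank (H - a *\<^sub>R self_outer u) < rank H"
    "(H - a *\<^sub>R self_outer u) *v v = 0" "cscalar v u \<noteq> 0"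
    using hermitian_deflation[OF H(1,2)] .
  let ?R = "H - a *\<^sub>R self_outer u"
  have "\<exists>b. \<exists>w\<in>mat_range ?R. ?R = b *\<^sub>R self_outer w"
  proof (cases "?R = 0")
    case True
    then show ?thesis
      by (intro exI[of _ 0] bexI[of _ 0]) (auto simp: mat_range_def image_iff)
  next
    case False
    then obtain b w where w: "w \<in> mat_range ?R"
      "rank (?R - b *\<^sub>R self_outer w) < rank ?R"
      using hermitian_deflation[OF u(3)] by metis
    then have "?R - b *\<^sub>R self_outer w = 0"
      using u(4) H(3) by (simp flip: rank_eq_0_iff_field)
    with w(1) show ?thesis
      by (metis eq_iff_diff_eq_0)
  qed
  then obtain b w where w: "w \<in> mat_range ?R" "?R = b *\<^sub>R self_outer w"
    by blast
  obtain z where z: "w = ?R *v z"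
    using w(1) by (auto simp: mat_range_def)
  have "cscalar v w = 0"
    using hermitian_cscalar_swap[OF u(3), of v z] u(5) by (simp add: z)
  then have indep: "u \<noteq> c *s w" for c
    using u(6) by (auto simp: cscalar_scale_right)
  have "w = H *v z + (- complex_of_real a * cscalar u z) *s u"
    by (simp add: z matrix_vector_mult_diff_rdistrib scaleR_matrix_mult_vec self_outer_mult_vec
        vec_eq_iff scaleR_conv_of_real[where 'a = complex])
  moreover have "H *v z \<in> mat_range H"
    by (simp add: mat_range_def)
  ultimately have "w \<in> mat_range H"
    using u(2) by (simp only: mat_range_add mat_range_cmul)
  moreover have "H = a *\<^sub>R self_outer u + b *\<^sub>R self_outer w"
    using w(2) by (simp add: algebra_simps)
  ultimately show ?thesis
    using that u(1,2) indep by blast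
qed

section \<open>Sparse signals and lifted measurements\<close>

lemma dict_span_eq:
  fixes D :: "complex^'d^'n"
  shows "dict_span D K = {D *v z | z. {j. z $ j \<noteq> 0} \<subseteq> K}" (is "_ = ?S")
proof
  have "vec.subspace ?S"
    unfolding vec.subspace_def
  proof (intro conjI ballI allI)
    show "0 \<in> ?S"
      by (auto intro!: exI[of _ 0])
    show "x + y \<in> ?S" if xy: "x \<in> ?S" "y \<in> ?S" for x y
    proof -
      obtain z t where "x = D *v z" "{j. z $ j \<noteq> 0} \<subseteq> K" "y = D *v t" "{j. t $ j \<noteq> 0} \<subseteq> K"
        using xy by blast
      then show ?thesis
        by (auto intro!: exI[of _ "z + t"] simp: matrix_vector_right_distrib) force
    qed
    show "c *s x \<in> ?S" if x: "x \<in> ?S" for c x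
    proof -
      obtain z where "x = D *v z" "{j. z $ j \<noteq> 0} \<subseteq> K"
        using x by blast
      then show ?thesis
        by (auto intro!: exI[of _ "c *s z"] simp: vector_scalar_commute)
    qed
  qed
  moreover have "(\<lambda>i. column i D) ` K \<subseteq> ?S"
  proof (intro image_subsetI CollectI exI conjI)
    show "column i D = D *v axis i 1" for i
      by (simp add: vec_eq_iff column_def matrix_vector_mult_def axis_def if_distrib cong: if_cong)
    show "{j. axis i (1 :: complex) $ j \<noteq> 0} \<subseteq> K" if "i \<in> K" for i
      using that by (auto simp: axis_def)
  qed
  ultimately show "dict_span D K \<subseteq> ?S"
    unfolding dict_span_def by (rule vec.span_minimal[rotated])
  show "?S \<subseteq> dict_span D K"
  proof clarify
    fix z :: "complex^'d" assume z: "{j. z $ j \<noteq> 0} \<subseteq> K"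
    have "z $ i *s column i D \<in> vec.span ((\<lambda>i. column i D) ` K)" for i
      using z by (cases "z $ i = 0") (auto intro!: vec.span_scale intro: vec.span_base simp: vec.span_zero)
    then show "D *v z \<in> dict_span D K"
      by (simp add: dict_span_def matrix_mult_sum vec.span_sum)
  qed
qed

lemma dict_span_mono: "K \<subseteq> L \<Longrightarrow> dict_span D K \<subseteq> dict_span D L"
  unfolding dict_span_def by (intro vec.span_mono image_mono)

lemma sparse_signals_iff: "x \<in> sparse_signals k D \<longleftrightarrow> (\<exists>K. card K \<le> k \<and> x \<in> dict_span D K)"
proof
  assume "x \<in> sparse_signals k D"
  then show "\<exists>K. card K \<le> k \<and> x \<in> dict_span D K"
    by (auto simp: sparse_signals_def l0_norm_def dict_span_eq)
next
  assume "\<exists>K. card K \<le> k \<and> x \<in> dict_span D K"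
  then obtain K z where "card K \<le> k" "x = D *v z" "{j. z $ j \<noteq> 0} \<subseteq> K"
    by (auto simp: dict_span_eq)
  moreover from this have "card {j. z $ j \<noteq> 0} \<le> k"
    by (meson card_mono finite le_trans)
  ultimately show "x \<in> sparse_signals k D"
    by (auto simp: sparse_signals_def l0_norm_def)
qed

text \<open>Cyclicity of the trace: \<open>tr (H\<^sup>* g g\<^sup>*) = g\<^sup>* H\<^sup>* g\<close>.\<close>

lemma hs_scalar_self_outer: "hs_scalar H (self_outer g) = cscalar (H *v g) g"
proof -
  have "hs_scalar H (self_outer g)
      = (\<Sum>j\<in>UNIV. \<Sum>i\<in>UNIV. cnj (H $ i $ j) * (g $ i * cnj (g $ j)))"
    by (simp add: hs_scalar_def trace_def matrix_matrix_mult_def conj_transpose_def self_outer_def)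
  also have "\<dots> = (\<Sum>i\<in>UNIV. \<Sum>j\<in>UNIV. cnj (H $ i $ j) * (g $ i * cnj (g $ j)))"
    by (rule sum.swap)
  also have "\<dots> = cscalar (H *v g) g"
    by (simp add: cscalar_def matrix_vector_mult_def sum_distrib_left sum_distrib_right mult_ac)
  finally show ?thesis .
qed

text \<open>
  The phaseless measurements of signals are linear in their outer products, so membership in the
  kernel becomes a relation between them.
\<close>

lemma phaselift_kernel_combination_iff:
  fixes f :: "'m::finite \<Rightarrow> complex^'n"
  shows "a *\<^sub>R self_outer u + b *\<^sub>R self_outer w \<in> phaselift_kernel f \<longleftrightarrow>
    (\<forall>i. a * (cmod (cscalar u (f i)))\<^sup>2 + b * (cmod (cscalar w (f i)))\<^sup>2 = 0)"
proof -
  have outer: "cscalar (self_outer x *v g) g = complex_of_real ((cmod (cscalar x g))\<^sup>2)"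
    for x g :: "complex^'n"
    by (simp only: self_outer_mult_vec cscalar_scale_left)
      (metis complex_norm_square mult.commute)
  have "hs_scalar (a *\<^sub>R self_outer u + b *\<^sub>R self_outer w) (self_outer g) = complex_of_real
      (a * (cmod (cscalar u g))\<^sup>2 + b * (cmod (cscalar w g))\<^sup>2)" for g
    by (simp only: hs_scalar_self_outer matrix_vector_mult_add_rdistrib scaleR_matrix_mult_vec
        cscalar_add_left cscalar_scaleR_left outer of_real_add of_real_mult)
  then show ?thesis
    by (simp only: phaselift_kernel_def phaselift_def mem_Collect_eq vec_eq_iff vec_lambda_beta
        zero_index of_real_eq_0_iff)
qed

text \<open>
  Where an entry of \<open>y\<close> is nonzero, the corresponding columns of the two equal matrices are
  nonzero multiples of \<open>x\<close> and \<open>y\<close>; the diagonals give equal moduli.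
\<close>

lemma self_outer_eq_imp_phase:
  assumes "self_outer x = self_outer y"
  obtains c where "cmod c = 1" "x = c *s y"
proof -
  have eq: "x $ i * cnj (x $ j) = y $ i * cnj (y $ j)" for i j
    using assms by (simp add: self_outer_def vec_eq_iff)
  have mod: "cmod (x $ j) = cmod (y $ j)" for j
  proof -
    have "(cmod (x $ j))\<^sup>2 = (cmod (y $ j))\<^sup>2"
      using eq[of j j] by (metis complex_norm_square of_real_eq_iff)
    then show ?thesis
      by (simp add: power2_eq_iff_nonneg)
  qed
  show ?thesis
  proof (cases "y = 0")
    case True
    then have "x = 0"
      using mod by (simp add: vec_eq_iff)
    with True that[of 1] show ?thesis
      by simp
  next
    case False
    then obtain j where j: "y $ j \<noteq> 0"
      by (auto simp: vec_eq_iff)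
    then have xj: "x $ j \<noteq> 0"
      using mod[of j] by auto
    define c where "c = cnj (y $ j) / cnj (x $ j)"
    have "cmod c = 1"
      using j mod[of j] by (simp add: c_def norm_divide)
    moreover have "x = c *s y"
      using eq[of _ j] xj by (simp add: vec_eq_iff c_def field_simps)
    ultimately show ?thesis
      by (rule that)
  qed
qed

lemma rank_self_outer_combination_le:
  "rank (a *\<^sub>R self_outer u + b *\<^sub>R self_outer w) \<le> 2"
proof -
  let ?u = "\<chi> j. cnj (u $ j)" and ?w = "\<chi> j. cnj (w $ j)"
  have "row i (a *\<^sub>R self_outer u + b *\<^sub>R self_outer w) =
      (complex_of_real a * u $ i) *s ?u + (complex_of_real b * w $ i) *s ?w" for i
    by (simp add: vec_eq_iff row_def self_outer_def scaleR_conv_of_real[where 'a = complex])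
  then have "rows (a *\<^sub>R self_outer u + b *\<^sub>R self_outer w) \<subseteq> vec.span {?u, ?w}"
    by (auto simp: rows_def intro!: vec.span_add vec.span_scale intro: vec.span_base)
  then have "rank (a *\<^sub>R self_outer u + b *\<^sub>R self_outer w) \<le> card {?u, ?w}"
    unfolding row_rank_def_gen by (rule vec.dim_le_card) simp
  also have "\<dots> \<le> 2"
    by (simp add: card_insert_if)
  finally show ?thesis .
qed

section \<open>Phase retrieval and the kernel of the lifted operator\<close>

text \<open>
  Two signals \<open>x\<close>, \<open>y\<close> with equal measurements give the kernel element \<open>x x\<^sup>* - y y\<^sup>*\<close>. Two supports of
  size at most \<open>k\<close> fit into a common one of size \<open>2 k\<close>, which explains the doubling of the
  sparsity level.
\<close>

lemma phase_retrieval_if_kernel_avoids: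
  fixes D :: "complex^'d^'n" and f :: "'m::finite \<Rightarrow> complex^'n"
  assumes k: "2 * k \<le> CARD('d)"
    and avoid: "\<And>K H. \<lbrakk>card K = 2 * k; H \<in> phaselift_kernel f; hermitian H;
      rank H = 1 \<or> rank H = 2; mat_range H \<subseteq> dict_span D K\<rbrakk> \<Longrightarrow> False"
  shows "allows_phase_retrieval k D f"
  unfolding allows_phase_retrieval_def
proof (intro ballI impI)
  fix x y
  assume "x \<in> sparse_signals k D" "y \<in> sparse_signals k D"
    and meas: "\<forall>i. (cmod (cscalar x (f i)))\<^sup>2 = (cmod (cscalar y (f i)))\<^sup>2"
  then obtain Kx Ky where "card Kx \<le> k" "card Ky \<le> k"
    and x: "x \<in> dict_span D Kx" and y: "y \<in> dict_span D Ky"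
    by (auto simp: sparse_signals_iff)
  then have "card (Kx \<union> Ky) \<le> 2 * k"
    using card_Un_le[of Kx Ky] by linarith
  then obtain K where K: "Kx \<union> Ky \<subseteq> K" "card K = 2 * k"
    using exists_subset_between[of "Kx \<union> Ky" "2 * k" UNIV] k by auto
  have xK: "x \<in> dict_span D K" and yK: "y \<in> dict_span D K"
    using x y K(1) dict_span_mono[of Kx K] dict_span_mono[of Ky K] by auto
  define H where "H = 1 *\<^sub>R self_outer x + (- 1) *\<^sub>R self_outer y"
  have "H *v z = cscalar x z *s x - cscalar y z *s y" for z
    by (simp add: H_def matrix_vector_mult_diff_rdistrib self_outer_mult_vec)
  then have "mat_range H \<subseteq> dict_span D K"
    using xK yK unfolding mat_range_def dict_span_def
    by (auto intro!: vec.span_diff vec.span_scale)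
  moreover have "hermitian H"
    using hermitian_diff[OF hermitian_scaleR_self_outer hermitian_scaleR_self_outer, of 1 x 1 y]
    by (simp add: H_def)
  moreover have "H \<in> phaselift_kernel f"
    unfolding H_def phaselift_kernel_combination_iff using meas by simp
  ultimately have "\<not> (rank H = 1 \<or> rank H = 2)"
    using avoid K(2) by blast
  moreover have "rank H \<le> 2"
    unfolding H_def by (rule rank_self_outer_combination_le)
  ultimately have "H = 0"
    by (subst rank_eq_0_iff_field[symmetric]) linarith
  then have "self_outer x = self_outer y"
    by (simp add: H_def)
  then show "\<exists>c. cmod c = 1 \<and> x = c *s y"
    by (rule self_outer_eq_imp_phase) blast
qed

text \<open>
  Write the kernel element as \<open>a u u\<^sup>* + b w w\<^sup>*\<close> with \<open>u\<close> not a multiple of \<open>w\<close>. If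
  \<open>a b \<le> 0\<close>, then \<open>u\<close> scaled by \<open>sqrt \<bar>a\<bar>\<close> and \<open>w\<close> scaled by \<open>sqrt \<bar>b\<bar>\<close> have equal
  measurements. If \<open>a b > 0\<close>, all the measurements of \<open>u\<close> vanish, so that \<open>u\<close> cannot be told
  apart from zero.
\<close>

lemma kernel_avoids_if_phase_retrieval:
  assumes pr: "allows_phase_retrieval k D f"
    and K: "card K \<le> k" and H: "H \<in> phaselift_kernel f" "hermitian H" "H \<noteq> 0" "rank H \<le> 2"
    and range: "mat_range H \<subseteq> dict_span D K"
  shows False
proof -
  obtain a b u w where a: "a \<noteq> 0" and uw: "u \<in> mat_range H" "w \<in> mat_range H"
    and H_eq: "H = a *\<^sub>R self_outer u + b *\<^sub>R self_outer w" and indep: "\<And>c. u \<noteq> c *s w"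
    using hermitian_rank_le_2_decomposition[OF H(2-4)] by metis
  have sum0: "a * (cmod (cscalar u (f i)))\<^sup>2 + b * (cmod (cscalar w (f i)))\<^sup>2 = 0" for i
    using H(1) by (simp add: H_eq phaselift_kernel_combination_iff)
  have sparse: "c *s x \<in> sparse_signals k D" if "x \<in> mat_range H" for c x
    using that mat_range_cmul[of x H c] K range by (auto simp: sparse_signals_iff)
  have no: False
    if meas: "\<And>i. (cmod (cscalar (c *s u) (f i)))\<^sup>2 = (cmod (cscalar (e *s w) (f i)))\<^sup>2" and c: "c \<noteq> 0"
    for c e
  proof -
    obtain t where "c *s u = t *s (e *s w)"
      using pr sparse[OF uw(1)] sparse[OF uw(2)] meas
      unfolding allows_phase_retrieval_def by blast
    then have "u = (t * e / c) *s w"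
      using c by (simp add: vec_eq_iff field_simps)
    with indep show False
      by blast
  qed
  show False
  proof (cases "a * b \<le> 0")
    case True
    have "\<bar>a\<bar> * (cmod (cscalar u (f i)))\<^sup>2 = \<bar>b\<bar> * (cmod (cscalar w (f i)))\<^sup>2" for i
      using sum0[of i] True a by (cases "a > 0") (auto simp: mult_le_0_iff abs_if)
    then show False
      using a
      by (intro no[of "complex_of_real (sqrt \<bar>a\<bar>)" "complex_of_real (sqrt \<bar>b\<bar>)"])
        (simp_all add: cscalar_scale_left norm_mult power_mult_distrib)
  next
    case False
    have "(cmod (cscalar u (f i)))\<^sup>2 = 0" for i
    proof -
      \<comment> \<open>Multiplying the relation by \<open>a\<close> makes both coefficients positive.\<close>
      have "a * a * (cmod (cscalar u (f i)))\<^sup>2 + a * b * (cmod (cscalar w (f i)))\<^sup>2 = 0"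
        using sum0[of i] by (metis distrib_left mult.assoc mult_zero_right)
      moreover have "0 \<le> a * b * (cmod (cscalar w (f i)))\<^sup>2"
        using False by simp
      ultimately have "a * a * (cmod (cscalar u (f i)))\<^sup>2 \<le> 0"
        by linarith
      then show ?thesis
        using a by (auto simp: mult_le_0_iff)
    qed
    then show False
      by (intro no[of 1 0]) simp_all
  qed
qed

theorem theorem3p1:
  fixes D :: "complex^'d^'n"
    and f :: "'m::finite \<Rightarrow> complex^'n"
    and k :: nat
  assumes "k > 0"
  shows "(2 * k \<le> CARD('d) \<longrightarrow>
          (\<forall>K :: 'd set. card K = 2 * k \<longrightarrow>
             \<not> (\<exists>H \<in> phaselift_kernel f. hermitian H \<and> (rank H = 1 \<or> rank H = 2)
                  \<and> mat_range H \<subseteq> dict_span D K)) \<longrightarrow>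
          allows_phase_retrieval k D f)
       \<and> (allows_phase_retrieval k D f \<longrightarrow>
          (\<forall>K :: 'd set. card K = k \<longrightarrow>
             \<not> (\<exists>H \<in> phaselift_kernel f. hermitian H \<and> (rank H = 1 \<or> rank H = 2)
                  \<and> mat_range H \<subseteq> dict_span D K)))"
proof (intro conjI impI allI notI)
  assume "2 * k \<le> CARD('d)"
    and "\<forall>K :: 'd set. card K = 2 * k \<longrightarrow>
      \<not> (\<exists>H \<in> phaselift_kernel f. hermitian H \<and> (rank H = 1 \<or> rank H = 2)
          \<and> mat_range H \<subseteq> dict_span D K)"
  then show "allows_phase_retrieval k D f"
    by (intro phase_retrieval_if_kernel_avoids) blast+
next
  fix K :: "'d set"
  assume "allows_phase_retrieval k D f" "card K = k"
    and "\<exists>H \<in> phaselift_kernel f. hermitian H \<and> (rank H = 1 \<or> rank H = 2)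
        \<and> mat_range H \<subseteq> dict_span D K"
  then obtain H where H: "H \<in> phaselift_kernel f" "hermitian H" "rank H = 1 \<or> rank H = 2"
    "mat_range H \<subseteq> dict_span D K"
    by blast
  moreover from H(3) have "H \<noteq> 0" "rank H \<le> 2"
    using rank_eq_0_iff_field[of H] by auto
  ultimately show False
    using kernel_avoids_if_phase_retrieval[of k D f K H] \<open>allows_phase_retrieval k D f\<close>
      \<open>card K = k\<close> by blast
qed

end
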